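(* Let $X\subseteq[\mathbb N]^\infty$ be a $\mathfrak b$-generalized tower. Then for every natural number $m$, the product space $(X\cup\mathrm{Fin})^m$ satisfies $\mathsf S_1(\Gamma,\Gamma)$.
   Context: $\mathbb N=\{1,2,\dots\}$; $[\mathbb N]^\infty$ is the set of infinite subsets of $\mathbb N$ and $\mathrm{Fin}$ the set of finite subsets of $\mathbb N$. Both are viewed as subspaces of $P(\mathbb N)$, which is identified with the Cantor space $\{0,1\}^{\mathbb N}$ via characteristic functions. Each $a\in[\mathbb N]^\infty$ is identified with its increasing enumeration $a(1)<a(2)<\cdots$. For $n<m$, $[n,m)=\{i\in\mathbb N: n\le i<m\}$. A set $X\subseteq[\mathbb N]^\infty$ is unbounded if for each $a\in[\mathbb N]^\infty$ there is $b\in X$ with $\{n: a(n)>b(n)\}$ infinite; $\mathfrak b$ is the minimal cardinality of an unbounded subset of $[\mathbb N]^\infty$. For an uncountable ordinal $\kappa$, a set $X\subseteq[\mathbb N]^\infty$ with $|X|\ge\kappa$ is a $\kappa$-generalized tower if for each $a\in[\mathbb N]^\infty$ there are $b\in[\mathbb N]^\infty$ and $S\subseteq X$ with $|S|<\kappa$ such that $x\cap\bigcup_{n\in b}[a(n),a(n+1))$ is finite for all $x\in X\setminus S$. A cover of a space is a family of proper subsets whose union is the whole space. A $\gamma$-cover is an infinite cover such that each point belongs to all but finitely many members; $\Gamma(X)$ is the family of all open $\gamma$-covers of $X$. $X$ satisfies $\mathsf S_1(\Gamma,\Gamma)$ if for each sequence $\mathcal U_1,\mathcal U_2,\dots\in\Gamma(X)$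 there are $U_1\in\mathcal U_1,U_2\in\mathcal U_2,\dots$ with $\{U_n:n\in\mathbb N\}\in\Gamma(X)$.
   Formalization: "Unbounded" is taken with {n: a(n)<b(n)} infinite instead of {n: a(n)>b(n)}; with the latter no set is unbounded (take a = N, so a(n)=n≤b(n)), and the cardinal b would be undefined. *)

theory Defs
  imports "HOL-Analysis.Analysis"
begin

unbundle cardinal_syntax

section \<open>Infinite and finite subsets of the positive integers\<close>

definition infsets :: "nat set set" where
  "infsets = {a. a \<subseteq> {1..} \<and> infinite a}"

definition finsets :: "nat set set" where
  "finsets = {a. a \<subseteq> {1..} \<and> finite a}"

text \<open>Enumerations start with index 1, whereas \<^const>\<open>enumerate\<close> starts with index 0;
  the value at index 0 is irrelevant.\<close>

definition enum :: "nat set \<Rightarrow> nat \<Rightarrow> nat" where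
  "enum a n = enumerate a (n - 1)"

section \<open>The cardinal number \<open>\<bb>\<close>\<close>

text \<open>The family is unbounded if it has no upper bound with respect to eventual
  dominance, so the inequality has to be \<open>a(n) < b(n)\<close>. With \<open>a(n) > b(n)\<close> instead,
  no family would be unbounded: see \<open>reversed_inequality_fails\<close> below.\<close>

definition unbounded :: "nat set set \<Rightarrow> bool" where
  "unbounded X \<longleftrightarrow> X \<subseteq> infsets \<and>
     (\<forall>a\<in>infsets. \<exists>b\<in>X. infinite {n\<in>{1..}. enum a n < enum b n})"

lemma reversed_inequality_fails:
  "\<not> (\<exists>X\<subseteq>infsets. \<forall>a\<in>infsets. \<exists>b\<in>X. infinite {n\<in>{1..}. enum a n > enum b n})"
proof
  assume "\<exists>X\<subseteq>infsets. \<forall>a\<in>infsets. \<exists>b\<in>X. infinite {n\<in>{1..}. enum a n > enum b n}"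
  then obtain X where X: "X \<subseteq> infsets"
    and *: "\<And>a. a \<in> infsets \<Longrightarrow> \<exists>b\<in>X. infinite {n\<in>{1..}. enum a n > enum b n}" by blast
  have N: "{1..} \<in> infsets" by (simp add: infsets_def infinite_Ici)
  have e: "enumerate {1::nat..} n = Suc n" for n
  proof (induction n)
    case 0 show ?case by (auto simp: enumerate_0 intro!: Least_equality)
  next
    case (Suc n)
    then show ?case
      by (subst enumerate_Suc'') (auto simp: infinite_Ici intro!: Least_equality)
  qed
  obtain b where b: "b \<in> X" and inf: "infinite {n\<in>{1..}. enum {1..} n > enum b n}"
    using *[OF N] by blast
  have bi: "b \<subseteq> {1..}" "infinite b" using b X by (auto simp: infsets_def)
  have "Suc n \<le> enumerate b n" for n
  proof (induction n)
    case 0 show ?case using enumerate_in_set[OF bi(2), of 0] bi(1) by auto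
  next
    case (Suc n) then show ?case using enumerate_step[OF bi(2), of n] by linarith
  qed
  then have "{n\<in>{1..}. enum {1..} n > enum b n} = {}"
    by (auto simp: enum_def e[simplified] not_less)
  then show False using inf by (metis finite.emptyI)
qed

text \<open>The value is determined up to order isomorphism \<open>=o\<close>.\<close>

definition bfrak :: "nat set rel" where
  "bfrak = (SOME r. \<exists>B. unbounded B \<and> r = |B| \<and> (\<forall>B'. unbounded B' \<longrightarrow> |B| \<le>o |B'| ))"

lemma unbounded_infsets: "unbounded infsets"
  unfolding unbounded_def
proof (intro conjI ballI)
  fix a assume a: "a \<in> infsets"
  then have ia: "infinite a" and sa: "a \<subseteq> {1..}" by (auto simp: infsets_def)
  let ?b = "a - {enumerate a 0}"
  have "?b \<in> infsets" using ia sa by (auto simp: infsets_def)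
  moreover have "enum a n < enum ?b n" for n
    using enumerate_step[OF ia] by (simp add: enum_def flip: enumerate_Suc')
  then have "{n\<in>{1..}. enum a n < enum ?b n} = {1..}" by auto
  then have "infinite {n\<in>{1..}. enum a n < enum ?b n}" by (simp add: infinite_Ici)
  ultimately show "\<exists>b\<in>infsets. infinite {n\<in>{1..}. enum a n < enum b n}" by blast
qed simp

lemma bfrak_min:
  obtains B where "unbounded B" "bfrak = |B|" "\<And>B'. unbounded B' \<Longrightarrow> |B| \<le>o |B'|"
proof -
  have "\<exists>r\<in>card_of ` Collect unbounded. \<forall>r'\<in>card_of ` Collect unbounded. r \<le>o r'"
  proof (rule exists_minim_Card_order)
    show "card_of ` Collect unbounded \<noteq> {}" using unbounded_infsets by blast
    show "\<forall>r\<in>card_of ` Collect unbounded. Card_order r"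
      by (intro ballI, elim imageE, hypsubst, rule card_of_Card_order)
  qed
  then have "\<exists>r B. unbounded B \<and> r = |B| \<and> (\<forall>B'. unbounded B' \<longrightarrow> |B| \<le>o |B'| )"
    by blast
  then have "\<exists>B. unbounded B \<and> bfrak = |B| \<and> (\<forall>B'. unbounded B' \<longrightarrow> |B| \<le>o |B'| )"
    unfolding bfrak_def by (rule someI_ex)
  then show ?thesis using that by blast
qed

lemma enumerate_range:
  fixes f :: "nat \<Rightarrow> nat"
  assumes "strict_mono f"
  shows "enumerate (range f) n = f n"
proof (induction n)
  case 0
  show ?case unfolding enumerate_0
    by (rule Least_equality) (use assms in \<open>auto simp: strict_mono_less_eq\<close>)
next
  case (Suc n)
  have inf: "infinite (range f)"
    using assms by (simp add: range_inj_infinite strict_mono_imp_inj_on)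
  show ?case
    by (subst enumerate_Suc''[OF inf], rule Least_equality)
       (use assms Suc in \<open>auto simp: strict_mono_less strict_mono_less_eq\<close>)
qed

lemma uncountable_bfrak: "uncountable (Field bfrak)"
proof -
  obtain B where B: "unbounded B" "bfrak = |B|" by (rule bfrak_min) blast
  have "uncountable B"
  proof
    assume c: "countable B"
    have "{1..} \<in> infsets" by (simp add: infsets_def infinite_Ici)
    then have "B \<noteq> {}" using B(1) by (auto simp: unbounded_def)
    then obtain g :: "nat \<Rightarrow> nat set" where g: "B = range g"
      using range_from_nat_into[OF _ c] by metis
    have gi: "infinite (g k)" for k using B(1) g by (auto simp: unbounded_def infsets_def)
    define f where "f n = Suc n + (\<Sum>k\<le>n. enumerate (g k) n)" for n
    have sm: "strict_mono f"
    proof (rule strict_monoI_Suc)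
      fix n
      have "(\<Sum>k\<le>n. enumerate (g k) n) \<le> (\<Sum>k\<le>n. enumerate (g k) (Suc n))"
        by (intro sum_mono less_imp_le enumerate_step gi)
      then show "f n < f (Suc n)" by (simp add: f_def)
    qed
    have "infinite (range f)"
      using sm by (simp add: range_inj_infinite strict_mono_imp_inj_on)
    moreover have "range f \<subseteq> {1..}" by (auto simp: f_def)
    ultimately have "range f \<in> infsets" by (simp add: infsets_def)
    then obtain k where
      inf: "infinite {n\<in>{1..}. enum (range f) n < enum (g k) n}"
      using B(1) g by (auto simp: unbounded_def)
    have le: "enumerate (g k) n \<le> f n" if "k \<le> n" for n
      using member_le_sum[of k "{..n}" "\<lambda>k. enumerate (g k) n"] that by (simp add: f_def)
    have "{n\<in>{1..}. enum (range f) n < enum (g k) n} \<subseteq> {..k}"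
    proof
      fix n assume "n \<in> {n\<in>{1..}. enum (range f) n < enum (g k) n}"
      then have "f (n - 1) < enumerate (g k) (n - 1)" by (simp add: enum_def enumerate_range[OF sm])
      then have "\<not> k \<le> n - 1" using le[of "n - 1"] by linarith
      then show "n \<in> {..k}" by simp
    qed
    then show False using inf finite_subset by blast
  qed
  then show ?thesis unfolding B(2) Field_card_of .
qed

section \<open>Generalized towers\<close>

text \<open>The uncountable ordinal \<open>\<kappa>\<close> is a well-order on an arbitrary carrier type.\<close>

definition generalized_tower :: "'k rel \<Rightarrow> nat set set \<Rightarrow> bool" where
  "generalized_tower \<kappa> X \<longleftrightarrow>
     Well_order \<kappa> \<and> uncountable (Field \<kappa>) \<and>
     X \<subseteq> infsets \<and> \<kappa> \<le>o |X| \<and>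
     (\<forall>a\<in>infsets. \<exists>b\<in>infsets. \<exists>S\<subseteq>X. |S| <o \<kappa> \<and>
        (\<forall>x\<in>X - S. finite (x \<inter> (\<Union>n\<in>b. {enum a n..<enum a (n + 1)}))))"

section \<open>The Cantor space topology on the power set\<close>

definition Cantor_space :: "(nat \<Rightarrow> bool) topology" where
  "Cantor_space = product_topology (\<lambda>_. discrete_topology UNIV) {1..}"

definition powerset_topology :: "nat set topology" where
  "powerset_topology = pullback_topology (Pow {1..}) (\<lambda>A. \<lambda>n\<in>{1..}. n \<in> A) Cantor_space"

section \<open>Covers and the selection principle\<close>

definition cover_of :: "'a topology \<Rightarrow> 'a set set \<Rightarrow> bool" where
  "cover_of T \<U> \<longleftrightarrow> (\<forall>U\<in>\<U>. U \<subset> topspace T) \<and> \<Union>\<U> = topspace T"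

definition gamma_cover :: "'a topology \<Rightarrow> 'a set set \<Rightarrow> bool" where
  "gamma_cover T \<U> \<longleftrightarrow> cover_of T \<U> \<and> infinite \<U> \<and>
     (\<forall>x\<in>topspace T. finite {U\<in>\<U>. x \<notin> U})"

definition Gamma_covers :: "'a topology \<Rightarrow> 'a set set set" where
  "Gamma_covers T = {\<U>. gamma_cover T \<U> \<and> (\<forall>U\<in>\<U>. openin T U)}"

definition S1_Gamma_Gamma :: "'a topology \<Rightarrow> bool" where
  "S1_Gamma_Gamma T \<longleftrightarrow>
     (\<forall>\<U> :: nat \<Rightarrow> 'a set set. (\<forall>n. \<U> n \<in> Gamma_covers T) \<longrightarrow>
        (\<exists>U. (\<forall>n. U n \<in> \<U> n) \<and> range U \<in> Gamma_covers T))"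

end

theory Submission
  imports Defs
begin

text \<open>
  Replacing the \<open>n\<close>-th cover by the intersections of corresponding members of the first \<open>n\<close>
  covers, one gets open sets \<open>V n k\<close>, decreasing in \<open>n\<close>, such that each point belongs to
  \<open>V n k\<close> for almost all \<open>k\<close>. If \<open>S \<subseteq> X\<close> has fewer than \<open>\<bb>\<close> elements, then so has
  \<open>S \<union> Fin\<close>, and the Galvin--Miller construction can be carried out simultaneously, modulo
  finitely many \<open>n\<close>, for all ways of prescribing some coordinates from \<open>S \<union> Fin\<close>: this
  uses eventual dominance twice. The tower property applied to the resulting intervals yields a
  selection \<open>\<sigma>\<close> and a small set \<open>S'\<close> such that each point with no coordinate in \<open>S' - S\<close>
  belongs to \<open>V n (\<sigma> n)\<close> for almost all \<open>n\<close>.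

  As \<open>V\<close> is decreasing in \<open>n\<close>, the points handled by \<open>\<sigma>\<close> remain handled by
  \<open>\<sigma> \<circ> \<tau>\<close> for each increasing \<open>\<tau>\<close>, so the step can be repeated with \<open>V n (\<sigma> k)\<close> and
  \<open>S \<union> S'\<close>. A point that is not handled gains a coordinate in the small set at each step, hence
  \<open>m + 1\<close> steps handle all points.
\<close>

section \<open>Cardinalities below \<open>\<bb>\<close>\<close>

text \<open>In the induction step the disjoint sum \<open>?M\<close> contains copies of both factors
  and is still smaller than \<open>C\<close>. An infinite \<open>?M\<close> is equipotent to its
  square; a finite one has a finite square.\<close>

lemma card_of_PiE_ordLess_infinite:
  assumes "finite J" "infinite C" "|T| <o |C|"
  shows "|PiE J (\<lambda>_. T)| <o |C|"
  using assms(1)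
proof (induction J)
  case empty
  show ?case using assms(2) by (intro finite_ordLess_infinite card_of_Well_order) (simp_all add: Field_card_of)
next
  case (insert j J)
  let ?M = "T <+> PiE J (\<lambda>_. T)"
  have M: "|?M| <o |C|"
    using card_of_Plus_ordLess_infinite[OF assms(2,3) insert.IH] .
  have "|?M \<times> ?M| <o |C|"
  proof (cases "finite ?M")
    case True
    then show ?thesis using assms(2)
      by (intro finite_ordLess_infinite card_of_Well_order) (simp_all add: Field_card_of)
  next
    case False
    then show ?thesis using M card_of_Times_same_infinite ordIso_ordLess_trans by blast
  qed
  moreover have "|T \<times> PiE J (\<lambda>_. T)| \<le>o |?M \<times> ?M|"
    unfolding card_of_ordLeq[symmetric]
    by (rule exI[of _ "map_prod Inl Inr"]) (auto simp: inj_on_def)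
  ultimately have "|T \<times> PiE J (\<lambda>_. T)| <o |C|"
    using ordLeq_ordLess_trans by blast
  then show ?case
    unfolding PiE_insert_eq using card_of_image ordLeq_ordLess_trans by blast
qed

lemma countable_ordLess_uncountable:
  assumes "countable A" "uncountable C"
  shows "|A| <o |C|"
proof -
  have "\<not> |C| \<le>o |A|"
    unfolding card_of_ordLeq[symmetric]
    using assms by (metis countable_image_inj_on countable_subset)
  then show ?thesis by (simp add: not_ordLeq_iff_ordLess[OF card_of_Well_order card_of_Well_order])
qed

lemma countable_finsets: "countable finsets"
  by (rule countable_subset[OF _ countable_Collect_finite]) (auto simp: finsets_def)

text \<open>Fewer than \<open>bfrak\<close> functions give too few sets to be unbounded, so one set
  \<open>a\<close> bounds them all. Its enumeration is strictly increasing, and it exceeds the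
  identity because \<open>a\<close> avoids 0.\<close>

lemma bfrak_dominating:
  fixes f :: "'d \<Rightarrow> nat \<Rightarrow> nat"
  assumes "|D| <o bfrak"
  obtains g where "strict_mono g" "\<And>n. n < g n"
    "\<And>d. d \<in> D \<Longrightarrow> \<forall>\<^sub>F n in sequentially. f d n \<le> g n"
proof -
  \<comment> \<open>The partial sums majorize \<open>f d\<close>; the summand \<open>Suc n\<close>
    makes them strictly increasing and positive, so that the range is in \<open>infsets\<close> and
    is enumerated by \<open>F d\<close>.\<close>
  define F where "F d n = Suc n + (\<Sum>k\<le>n. f d k)" for d n
  have F: "strict_mono (F d)" for d
    by (rule strict_monoI_Suc) (simp add: F_def)
  have fF: "f d n \<le> F d n" for d n
    by (simp add: F_def le_SucI flip: lessThan_Suc_atMost)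
  define B where "B = (\<lambda>d. range (F d)) ` D"
  have B: "B \<subseteq> infsets"
    using F by (auto simp: B_def infsets_def F_def[abs_def] range_inj_infinite strict_mono_imp_inj_on)
  have "\<not> unbounded B"
  proof
    assume "unbounded B"
    then have "bfrak \<le>o |B|" by (metis bfrak_min)
    moreover have "|B| <o bfrak"
      using assms card_of_image ordLeq_ordLess_trans unfolding B_def by blast
    ultimately show False using not_ordLess_ordLeq by blast
  qed
  then obtain a where a: "a \<in> infsets"
    and bd: "\<And>b. b \<in> B \<Longrightarrow> finite {n\<in>{1..}. enum a n < enum b n}"
    using B unfolding unbounded_def by blast
  have ia: "infinite a" and pa: "a \<subseteq> {1..}" using a by (auto simp: infsets_def)
  show thesis
  proof
    show mono: "strict_mono (enumerate a)"
      using ia by (rule strict_mono_enumerate)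
    show "n < enumerate a n" for n
    proof (induction n)
      case 0
      show ?case using enumerate_in_set[OF ia, of 0] pa by auto
    next
      case (Suc n)
      then show ?case using enumerate_step[OF ia, of n] by linarith
    qed
    show "\<forall>\<^sub>F n in sequentially. f d n \<le> enumerate a n" if "d \<in> D" for d
    proof -
      have "finite {n\<in>{1..}. enum a n < enum (range (F d)) n}"
        using that by (intro bd) (auto simp: B_def)
      then obtain M where "\<And>n. n \<in> {1..} \<Longrightarrow> enum a n < enum (range (F d)) n \<Longrightarrow> n < M"
        using finite_nat_set_iff_bounded by (metis (mono_tags, lifting) mem_Collect_eq)
      \<comment> \<open>The shift by \<open>Suc\<close> compensates for \<open>enum\<close> starting
        at index 1.\<close>
      from this[of "Suc _"] have "F d n \<le> enumerate a n" if "n \<ge> M" for n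
        using that by (force simp: enum_def enumerate_range[OF F] not_less[symmetric])
      then show ?thesis
        using fF[of d] unfolding eventually_sequentially by (meson le_trans)
    qed
  qed
qed

section \<open>Open sets in finite powers\<close>

text \<open>Openness relative to \<open>Y\<close>, expressed by basic neighbourhoods; one
  \<open>N\<close> can serve all coordinates when \<open>J\<close> is finite.\<close>

definition prefix_open :: "'i set \<Rightarrow> ('i \<Rightarrow> nat set) set \<Rightarrow> ('i \<Rightarrow> nat set) set \<Rightarrow> bool" where
  "prefix_open J Y U \<longleftrightarrow>
     (\<forall>x\<in>U. \<exists>N. \<forall>y\<in>Y. (\<forall>i\<in>J. y i \<inter> {..<N} = x i \<inter> {..<N}) \<longrightarrow> y \<in> U)"

lemma prefix_eq_mono:
  fixes A B :: "nat set"
  assumes "A \<inter> {..<M} = B \<inter> {..<M}" "N \<le> M"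
  shows "A \<inter> {..<N} = B \<inter> {..<N}"
proof -
  have "{..<N} = {..<M} \<inter> {..<N}" using assms(2) by auto
  then show ?thesis using assms(1) by (metis Int_assoc)
qed

text \<open>Neighbourhoods shrink as \<open>N\<close> grows. The eventual form lets finitely many
  points share one \<open>N\<close>.\<close>

lemma prefix_openD:
  assumes "prefix_open J Y U" "x \<in> U"
  shows "\<forall>\<^sub>F N in sequentially. \<forall>y\<in>Y. (\<forall>i\<in>J. y i \<inter> {..<N} = x i \<inter> {..<N}) \<longrightarrow> y \<in> U"
proof -
  from bspec[OF assms(1)[unfolded prefix_open_def] assms(2)]
  obtain N where N: "\<forall>y\<in>Y. (\<forall>i\<in>J. y i \<inter> {..<N} = x i \<inter> {..<N}) \<longrightarrow> y \<in> U"
    by (elim exE) (rule that)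
  show ?thesis
    unfolding eventually_sequentially
  proof (intro exI allI impI ballI)
    fix M y assume "N \<le> M" "y \<in> Y" and eq: "\<forall>i\<in>J. y i \<inter> {..<M} = x i \<inter> {..<M}"
    have "\<forall>i\<in>J. y i \<inter> {..<N} = x i \<inter> {..<N}"
      by (intro ballI prefix_eq_mono[OF bspec[OF eq] \<open>N \<le> M\<close>])
    then show "y \<in> U" using bspec[OF N \<open>y \<in> Y\<close>] by (rule rev_mp)
  qed
qed

text \<open>A basic open set of the product restricts only finitely many coordinates;
  \<open>N\<close> is taken beyond all of them.\<close>

lemma openin_powerset_topology_prefix:
  assumes "openin powerset_topology U" "A \<in> U"
  shows "\<exists>N. \<forall>B\<subseteq>{1..}. B \<inter> {..<N} = A \<inter> {..<N} \<longrightarrow> B \<in> U"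
proof -
  let ?r = "\<lambda>A. \<lambda>n\<in>{1::nat..}. n \<in> A"
  obtain W where W: "openin Cantor_space W" "U = ?r -` W \<inter> Pow {1..}"
    using assms(1) unfolding powerset_topology_def openin_pullback_topology by blast
  then have "?r A \<in> W" using assms(2) by auto
  from product_topology_open_contains_basis[OF W(1)[unfolded Cantor_space_def] this]
  obtain Z where Z: "?r A \<in> PiE {1..} Z" "finite {i. Z i \<noteq> UNIV}" "PiE {1..} Z \<subseteq> W"
    by auto
  obtain N where N: "\<And>i. Z i \<noteq> UNIV \<Longrightarrow> i < N"
    using Z(2) finite_nat_set_iff_bounded by (metis (mono_tags, lifting) mem_Collect_eq)
  have "B \<in> U" if B: "B \<subseteq> {1..}" "B \<inter> {..<N} = A \<inter> {..<N}" for B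
  proof -
    have "?r B \<in> PiE {1..} Z"
    proof (rule PiE_I)
      fix i :: nat assume i: "i \<in> {1..}"
      show "?r B i \<in> Z i"
      proof (cases "i < N")
        case True
        then have "i \<in> B \<longleftrightarrow> i \<in> A" using B(2) by auto
        then show ?thesis using PiE_mem[OF Z(1) i] i by simp
      qed (use N in blast)
    qed simp
    then have "?r B \<in> W" using Z(3) by blast
    then show ?thesis using B(1) W(2) by blast
  qed
  then show ?thesis by blast
qed

lemma topspace_powerset_topology [simp]: "topspace powerset_topology = Pow {1..}"
  by (auto simp: powerset_topology_def topspace_pullback_topology Cantor_space_def)

lemma openin_power_prefix_open:
  assumes "finite J" "Q \<subseteq> Pow {1..}"
    and U: "openin (product_topology (\<lambda>_. subtopology powerset_topology Q) J) U"
  shows "prefix_open J (PiE J (\<lambda>_. Q)) U"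
  unfolding prefix_open_def
proof
  fix x assume x: "x \<in> U"
  obtain Z where Z: "x \<in> PiE J Z" "\<And>i. openin (subtopology powerset_topology Q) (Z i)"
    "PiE J Z \<subseteq> U"
    using product_topology_open_contains_basis[OF U x] by blast
  have "\<forall>\<^sub>F N in sequentially. \<forall>B\<in>Q. B \<inter> {..<N} = x i \<inter> {..<N} \<longrightarrow> B \<in> Z i" if i: "i \<in> J" for i
  proof -
    obtain W where W: "openin powerset_topology W" "Z i = W \<inter> Q"
      using Z(2)[of i] by (auto simp: openin_subtopology)
    have "x i \<in> W" using PiE_mem[OF Z(1) i] W(2) by blast
    from openin_powerset_topology_prefix[OF W(1) this]
    obtain N where N: "\<And>B. B \<subseteq> {1..} \<Longrightarrow> B \<inter> {..<N} = x i \<inter> {..<N} \<Longrightarrow> B \<in> W"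
      by blast
    have "B \<in> Z i" if "N \<le> M" "B \<in> Q" "B \<inter> {..<M} = x i \<inter> {..<M}" for M B
      using N[OF _ prefix_eq_mono[OF that(3,1)]] that(2) W(2) assms(2) by blast
    then show ?thesis unfolding eventually_sequentially by blast
  qed
  then have "\<forall>\<^sub>F N in sequentially. \<forall>i\<in>J. \<forall>B\<in>Q. B \<inter> {..<N} = x i \<inter> {..<N} \<longrightarrow> B \<in> Z i"
    using assms(1) by (intro eventually_ball_finite) auto
  from eventually_happens'[OF sequentially_bot this]
  obtain N where N: "\<forall>i\<in>J. \<forall>B\<in>Q. B \<inter> {..<N} = x i \<inter> {..<N} \<longrightarrow> B \<in> Z i"
    by (elim exE) (rule that)
  have "y \<in> U" if "y \<in> PiE J (\<lambda>_. Q)" "\<forall>i\<in>J. y i \<inter> {..<N} = x i \<inter> {..<N}" for y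
    using N that Z(3) by (intro subsetD[OF Z(3)]) (auto simp: PiE_iff)
  then show "\<exists>N. \<forall>y\<in>PiE J (\<lambda>_. Q). (\<forall>i\<in>J. y i \<inter> {..<N} = x i \<inter> {..<N}) \<longrightarrow> y \<in> U"
    by blast
qed

section \<open>The selection\<close>

text \<open>A point \<open>x\<close> is compared with \<open>merge p z\<close>, which copies the
  coordinates in \<open>S \<union> finsets\<close> and cuts the others at \<open>l\<close>. If those
  others avoid \<open>[l, h l)\<close>, the two agree below \<open>h l\<close>. Here
  \<open>g\<close> puts \<open>merge p z\<close> into \<open>V l (g l)\<close>, and \<open>h\<close>
  makes agreement below \<open>h l\<close> enough to bring \<open>x\<close> in as well.\<close>

lemma tower_selection_step:
  fixes V :: "nat \<Rightarrow> nat \<Rightarrow> ('i \<Rightarrow> nat set) set"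
  assumes tower: "generalized_tower bfrak X" and J: "finite J"
    and S: "S \<subseteq> X" "|S| <o bfrak"
    and opn: "\<And>n k. prefix_open J (PiE J (\<lambda>_. X \<union> finsets)) (V n k)"
    and dec: "\<And>i j k. i \<le> j \<Longrightarrow> V j k \<subseteq> V i k"
    and ev: "\<And>n x. x \<in> PiE J (\<lambda>_. X \<union> finsets) \<Longrightarrow> \<forall>\<^sub>F k in sequentially. x \<in> V n k"
  obtains \<sigma> S' where "strict_mono \<sigma>" "S' \<subseteq> X" "|S'| <o bfrak"
    "\<And>x. x \<in> PiE J (\<lambda>_. S \<union> finsets \<union> (X - S')) \<Longrightarrow> \<forall>\<^sub>F n in sequentially. x \<in> V n (\<sigma> n)"
proof -
  define Y where "Y = PiE J (\<lambda>_. X \<union> finsets)"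
  have X: "X \<subseteq> infsets" using tower by (simp add: generalized_tower_def)
  have pos: "A \<subseteq> {1..}" if "A \<in> X \<union> finsets" for A
    using that X by (auto simp: infsets_def finsets_def)
  \<comment> \<open>An element of \<open>D\<close> prescribes some of the coordinates; \<open>UNIV\<close>, which contains \<open>0\<close>
    and so is not in \<open>X \<union> finsets\<close>, marks the free ones.\<close>
  define T where "T = insert UNIV (S \<union> finsets)"
  define D where "D = PiE J (\<lambda>_. T)"
  define merge where "merge p z = (\<lambda>i\<in>J. if p i = UNIV then z i else p i)"
    for p z :: "'i \<Rightarrow> nat set"
  \<comment> \<open>All possible traces below \<open>l\<close> of the free coordinates. There are
    finitely many, so one threshold \<open>K p l\<close>, and later one \<open>N p l\<close>, serves
    them all.\<close>
  define F where "F l = PiE J (\<lambda>_. Pow {1..<l})" for l :: nat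
  have finF: "finite (F l)" for l
    using J by (auto simp: F_def intro!: finite_PiE)
  have mergeY: "merge p z \<in> Y" if "p \<in> D" "z \<in> F l" for p z l
  proof -
    have "z i \<in> finsets" if "i \<in> J" for i
      using PiE_mem[OF \<open>z \<in> F l\<close>[unfolded F_def] that] by (auto simp: finsets_def finite_subset)
    moreover have "p i \<in> T" if "i \<in> J" for i
      using PiE_mem[OF \<open>p \<in> D\<close>[unfolded D_def] that] .
    ultimately have "merge p z i \<in> X \<union> finsets" if "i \<in> J" for i
      using that S(1) unfolding merge_def T_def by (cases "p i = UNIV") auto
    then show ?thesis by (simp add: Y_def merge_def PiE_iff)
  qed
  have smallD: "|D| <o bfrak"
  proof -
    obtain B where B: "bfrak = |B|" by (rule bfrak_min) blast
    have "uncountable B" using uncountable_bfrak by (simp add: B Field_card_of)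
    moreover from this have iB: "infinite B" using uncountable_infinite by blast
    ultimately have "|{UNIV} \<union> (S \<union> finsets)| <o |B|"
      using S(2)[unfolded B] countable_finsets
      by (intro card_of_Un_ordLess_infinite[OF iB] countable_ordLess_uncountable[of "{UNIV}"]
          countable_ordLess_uncountable[of finsets]) simp_all
    then show ?thesis
      unfolding B D_def T_def using card_of_PiE_ordLess_infinite[OF J iB] by simp
  qed
  have "\<exists>K. \<forall>k\<ge>K. \<forall>z\<in>F l. merge p z \<in> V l k" if "p \<in> D" for p l
    unfolding eventually_sequentially[symmetric]
    by (intro eventually_ball_finite[OF finF] ballI ev) (rule mergeY[OF that, unfolded Y_def])
  then obtain K where K: "\<And>p l. p \<in> D \<Longrightarrow> \<forall>k\<ge>K p l. \<forall>z\<in>F l. merge p z \<in> V l k"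
    by metis
  obtain g where g: "strict_mono g"
    and Kg: "\<And>p. p \<in> D \<Longrightarrow> \<forall>\<^sub>F l in sequentially. K p l \<le> g l"
    using bfrak_dominating[OF smallD] by metis
  \<comment> \<open>This prefix length depends on \<open>g\<close>, so \<open>h\<close> has to come
    from a second application of dominance.\<close>
  have "\<exists>N. \<forall>M\<ge>N. \<forall>z\<in>F l. merge p z \<in> V l (g l) \<longrightarrow>
      (\<forall>y\<in>Y. (\<forall>i\<in>J. y i \<inter> {..<M} = merge p z i \<inter> {..<M}) \<longrightarrow> y \<in> V l (g l))" for p l
    unfolding eventually_sequentially[symmetric]
  proof (intro eventually_ball_finite[OF finF] ballI)
    fix z
    show "\<forall>\<^sub>F M in sequentially. merge p z \<in> V l (g l) \<longrightarrow>
      (\<forall>y\<in>Y. (\<forall>i\<in>J. y i \<inter> {..<M} = merge p z i \<inter> {..<M}) \<longrightarrow> y \<in> V l (g l))"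
      using prefix_openD[OF opn[of l "g l", folded Y_def], of "merge p z"]
      by (cases "merge p z \<in> V l (g l)") auto
  qed
  then have "\<exists>N. \<forall>p l. \<forall>M\<ge>N p l. \<forall>z\<in>F l. merge p z \<in> V l (g l) \<longrightarrow>
      (\<forall>y\<in>Y. (\<forall>i\<in>J. y i \<inter> {..<M} = merge p z i \<inter> {..<M}) \<longrightarrow> y \<in> V l (g l))"
    by (intro choice allI)
  then obtain N where N: "\<forall>p l. \<forall>M\<ge>N p l. \<forall>z\<in>F l. merge p z \<in> V l (g l) \<longrightarrow>
      (\<forall>y\<in>Y. (\<forall>i\<in>J. y i \<inter> {..<M} = merge p z i \<inter> {..<M}) \<longrightarrow> y \<in> V l (g l))"
    by (elim exE) (rule that)
  obtain h where h: "strict_mono h" "\<And>l. l < h l"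
    and Nh: "\<And>p. p \<in> D \<Longrightarrow> \<forall>\<^sub>F l in sequentially. N p l \<le> h l"
    using bfrak_dominating[OF smallD] by metis
  \<comment> \<open>The orbit of 0 under \<open>h\<close>: consecutive terms bound an interval
    \<open>[a j, h (a j))\<close>. It begins with \<open>h 0\<close> rather than 0 to stay among the
    positive integers.\<close>
  define a where "a j = (h ^^ Suc j) 0" for j
  have a_Suc: "a (Suc j) = h (a j)" for j by (simp add: a_def)
  have a: "strict_mono a" by (rule strict_monoI_Suc) (simp add: a_Suc h)
  have "0 < a j" for j
    using h(2) by (simp add: a_def) (metis gr_zeroI not_less_zero)
  then have "range a \<in> infsets"
    using a by (auto simp: infsets_def range_inj_infinite strict_mono_imp_inj_on Suc_le_eq)
  moreover have "\<forall>a\<in>infsets. \<exists>b\<in>infsets. \<exists>S\<subseteq>X. |S| <o bfrak \<and>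
      (\<forall>x\<in>X - S. finite (x \<inter> (\<Union>n\<in>b. {enum a n..<enum a (n + 1)})))"
    using tower unfolding generalized_tower_def by (elim conjE)
  ultimately have "\<exists>b\<in>infsets. \<exists>S\<subseteq>X. |S| <o bfrak \<and>
      (\<forall>x\<in>X - S. finite (x \<inter> (\<Union>n\<in>b. {enum (range a) n..<enum (range a) (n + 1)})))"
    by (rule bspec[rotated])
  then obtain b S' where b: "b \<in> infsets" and S': "S' \<subseteq> X" "|S'| <o bfrak"
    and bS': "\<forall>x\<in>X - S'.
      finite (x \<inter> (\<Union>n\<in>b. {enum (range a) n..<enum (range a) (n + 1)}))"
    by (elim bexE exE conjE) (rule that)
  have ib: "infinite b" and pb: "b \<subseteq> {1..}" using b by (auto simp: infsets_def)
  \<comment> \<open>Since \<open>enum (range a) n\<close> is \<open>a (n - 1)\<close>, the tower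
    interval with index \<open>enumerate b i\<close> is \<open>[c i, h (c i))\<close>.\<close>
  define c where "c i = a (enumerate b i - 1)" for i
  have eb: "1 \<le> enumerate b i" for i using enumerate_in_set[OF ib, of i] pb by auto
  have pred: "strict_mono (\<lambda>i. enumerate b i - 1)"
    by (rule strict_monoI_Suc) (use eb enumerate_step[OF ib] in \<open>simp add: diff_less_mono\<close>)
  have c: "strict_mono c"
    using strict_mono_o[OF a pred] by (simp add: c_def[abs_def] o_def)
  have hc: "h (c i) = a (enumerate b i)" for i
    using eb[of i] by (simp add: c_def flip: a_Suc)
  have avoid: "\<forall>\<^sub>F i in sequentially. A \<inter> {c i..<h (c i)} = {}" if A: "A \<in> X - S'" for A
  proof -
    obtain M where M: "\<And>k. k \<in> A \<inter> (\<Union>n\<in>b. {enum (range a) n..<enum (range a) (n + 1)}) \<Longrightarrow> k < M"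
      using bspec[OF bS' A] unfolding finite_nat_set_iff_bounded by (elim exE) (rule that, erule bspec)
    \<comment> \<open>As \<open>c i \<ge> i\<close>, these intervals lie above the whole finite
      intersection.\<close>
    have "A \<inter> {c i..<h (c i)} = {}" if "i \<ge> M" for i
    proof (rule ccontr)
      assume "A \<inter> {c i..<h (c i)} \<noteq> {}"
      then obtain k where k: "k \<in> A" "c i \<le> k" "k < h (c i)" by auto
      then have "k \<in> A \<inter> (\<Union>n\<in>b. {enum (range a) n..<enum (range a) (n + 1)})"
        using enumerate_in_set[OF ib, of i] hc[of i]
        by (auto simp: enum_def enumerate_range[OF a] c_def intro!: bexI[of _ "enumerate b i"])
      then have "k < M" by (rule M)
      then show False using k(2) that strict_mono_imp_increasing[OF c, of i] by linarith
    qed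
    then show ?thesis unfolding eventually_sequentially by blast
  qed
  show thesis
  proof (rule that)
    show "strict_mono (\<lambda>i. g (c i))" using strict_mono_o[OF g c] by (simp add: o_def)
    fix x assume x: "x \<in> PiE J (\<lambda>_. S \<union> finsets \<union> (X - S'))"
    then have xY: "x \<in> Y" using S(1) by (fastforce simp: Y_def PiE_iff)
    \<comment> \<open>A coordinate in \<open>S\<close> counts as prescribed even if it is also in
      \<open>S'\<close>; each free one is in \<open>X - S'\<close> and so avoids almost all
      intervals.\<close>
    define p where "p = (\<lambda>i\<in>J. if x i \<in> S \<union> finsets then x i else UNIV)"
    have pD: "p \<in> D" by (auto simp: p_def D_def T_def)
    have "\<forall>\<^sub>F n in sequentially. \<forall>i\<in>{i\<in>J. x i \<notin> S \<union> finsets}. x i \<inter> {c n..<h (c n)} = {}"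
    proof (intro eventually_ball_finite ballI)
      fix i assume "i \<in> {i\<in>J. x i \<notin> S \<union> finsets}"
      then show "\<forall>\<^sub>F n in sequentially. x i \<inter> {c n..<h (c n)} = {}"
        using x by (intro avoid) (auto simp: PiE_iff)
    qed (use J in simp)
    moreover have "\<forall>\<^sub>F n in sequentially. K p (c n) \<le> g (c n)"
      using eventually_subseq[OF c Kg[OF pD]] .
    moreover have "\<forall>\<^sub>F n in sequentially. N p (c n) \<le> h (c n)"
      using eventually_subseq[OF c Nh[OF pD]] .
    ultimately show "\<forall>\<^sub>F n in sequentially. x \<in> V n (g (c n))"
    proof eventually_elim
      case (elim n)
      define l where "l = c n"
      define z where "z = (\<lambda>i\<in>J. x i \<inter> {1..<l})"
      have z: "z \<in> F l" by (auto simp: z_def F_def)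
      have "x \<in> V l (g l)"
      proof (rule N[rule_format, OF elim(3)[folded l_def] z _ xY])
        show "merge p z \<in> V l (g l)"
          using K[OF pD] elim(2)[folded l_def] z by blast
        fix i assume i: "i \<in> J"
        then have xi: "x i \<in> X \<union> finsets" using xY by (auto simp: Y_def)
        show "x i \<inter> {..<h l} = merge p z i \<inter> {..<h l}"
        proof (cases "x i \<in> S \<union> finsets")
          case True
          moreover have "x i \<noteq> UNIV" using pos[OF xi] by auto
          ultimately show ?thesis using i by (simp add: merge_def p_def)
        next
          case False
          then have disj: "x i \<inter> {l..<h l} = {}" using elim(1) i by (simp add: l_def)
          have "k < l" if "k \<in> x i" "k < h l" for k
          proof (rule ccontr)
            assume "\<not> k < l"
            then have "k \<in> x i \<inter> {l..<h l}" using that by simp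
            then show False using disj by simp
          qed
          then have "x i \<inter> {..<h l} = x i \<inter> {1..<l} \<inter> {..<h l}"
            using pos[OF xi] by auto
          then show ?thesis using i False by (simp add: merge_def p_def z_def)
        qed
      qed
      \<comment> \<open>Membership was obtained at level \<open>l = c n\<close>; monotonicity of
        \<open>V\<close> brings it down to level \<open>n\<close>.\<close>
      moreover have "n \<le> l" using strict_mono_imp_increasing[OF c] by (simp add: l_def)
      ultimately show ?case using dec unfolding l_def by blast
    qed
  qed (use S' in auto)
qed

lemma tower_selection:
  fixes V :: "nat \<Rightarrow> nat \<Rightarrow> ('i \<Rightarrow> nat set) set"
  assumes tower: "generalized_tower bfrak X" and J: "finite J"
    and opn: "\<And>n k. prefix_open J (PiE J (\<lambda>_. X \<union> finsets)) (V n k)"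
    and dec: "\<And>i j k. i \<le> j \<Longrightarrow> V j k \<subseteq> V i k"
    and ev: "\<And>n x. x \<in> PiE J (\<lambda>_. X \<union> finsets) \<Longrightarrow> \<forall>\<^sub>F k in sequentially. x \<in> V n k"
  obtains \<sigma> where
    "\<And>x. x \<in> PiE J (\<lambda>_. X \<union> finsets) \<Longrightarrow> \<forall>\<^sub>F n in sequentially. x \<in> V n (\<sigma> n)"
proof -
  obtain B where B: "bfrak = |B|" by (rule bfrak_min) blast
  have uB: "uncountable B" using uncountable_bfrak by (simp add: B Field_card_of)
  then have iB: "infinite B" using uncountable_infinite by blast
  \<comment> \<open>The set \<open>S\<close> may grow with \<open>r\<close>. The claim is vacuous
    for \<open>r = 0\<close>, and for \<open>r = Suc (card J)\<close> it covers every point.\<close>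
  have "\<exists>\<sigma> S. strict_mono \<sigma> \<and> S \<subseteq> X \<and> |S| <o bfrak \<and>
      (\<forall>x\<in>PiE J (\<lambda>_. X \<union> finsets). card {j\<in>J. x j \<in> S} < r \<longrightarrow>
        (\<forall>\<^sub>F n in sequentially. x \<in> V n (\<sigma> n)))" for r
  proof (induction r)
    case 0
    have "|{} :: nat set set| <o bfrak"
      using uB by (simp add: B countable_ordLess_uncountable)
    then show ?case by (intro exI[of _ "\<lambda>n. n"] exI[of _ "{}"]) (auto simp: strict_mono_def)
  next
    case (Suc r)
    then obtain \<sigma> S where \<sigma>: "strict_mono \<sigma>" and S: "S \<subseteq> X" "|S| <o bfrak"
      and IH: "\<forall>x\<in>PiE J (\<lambda>_. X \<union> finsets). card {j\<in>J. x j \<in> S} < r \<longrightarrow>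
        (\<forall>\<^sub>F n in sequentially. x \<in> V n (\<sigma> n))"
      by (elim exE conjE) (rule that)
    obtain \<tau> S' where \<tau>: "strict_mono \<tau>" and S': "S' \<subseteq> X" "|S'| <o bfrak"
      and step: "\<And>x. x \<in> PiE J (\<lambda>_. S \<union> finsets \<union> (X - S'))
        \<Longrightarrow> \<forall>\<^sub>F n in sequentially. x \<in> V n (\<sigma> (\<tau> n))"
    proof (rule tower_selection_step[OF tower J S, of "\<lambda>n k. V n (\<sigma> k)"])
      show "\<forall>\<^sub>F k in sequentially. x \<in> V n (\<sigma> k)"
        if "x \<in> PiE J (\<lambda>_. X \<union> finsets)" for n x
        using eventually_subseq[OF \<sigma> ev[OF that]] .
    qed (rule opn, erule dec, (rule that; assumption))
    have "\<forall>\<^sub>F n in sequentially. x \<in> V n (\<sigma> (\<tau> n))"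
      if x: "x \<in> PiE J (\<lambda>_. X \<union> finsets)" and r: "card {j\<in>J. x j \<in> S \<union> S'} < Suc r" for x
    proof (cases "\<exists>j\<in>J. x j \<in> S' - S")
      case True
      then have "{j\<in>J. x j \<in> S} \<subset> {j\<in>J. x j \<in> S \<union> S'}" by blast
      then have "card {j\<in>J. x j \<in> S} < card {j\<in>J. x j \<in> S \<union> S'}"
        using J by (intro psubset_card_mono) auto
      then have "card {j\<in>J. x j \<in> S} < r" using r by linarith
      \<comment> \<open>Along \<open>\<tau>\<close> the point lies in
        \<open>V (\<tau> n) (\<sigma> (\<tau> n))\<close>, which is contained in
        \<open>V n (\<sigma> (\<tau> n))\<close> because \<open>n \<le> \<tau> n\<close>.\<close>
      from eventually_subseq[OF \<tau> IH[rule_format, OF x this]]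
      show ?thesis
        by (rule eventually_mono) (use dec strict_mono_imp_increasing[OF \<tau>] in blast)
    next
      case False
      then show ?thesis using x by (intro step) (auto simp: PiE_iff)
    qed
    moreover have "|S \<union> S'| <o bfrak"
      using card_of_Un_ordLess_infinite[OF iB] S(2) S'(2) by (simp add: B)
    ultimately show ?case
      using strict_mono_o[OF \<sigma> \<tau>, unfolded o_def] S(1) S'(1)
      by (intro exI[of _ "\<lambda>n. \<sigma> (\<tau> n)"] exI[of _ "S \<union> S'"]) auto
  qed
  from this[of "Suc (card J)"] obtain \<sigma> S where
    "\<forall>x\<in>PiE J (\<lambda>_. X \<union> finsets). card {j\<in>J. x j \<in> S} < Suc (card J) \<longrightarrow>
        (\<forall>\<^sub>F n in sequentially. x \<in> V n (\<sigma> n))"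
    by (elim exE conjE) (rule that)
  moreover have "card {j\<in>J. x j \<in> S} < Suc (card J)" for x
    using J by (intro le_imp_less_Suc card_mono) auto
  ultimately show thesis by (intro that[of \<sigma>]) blast
qed

text \<open>The range is infinite: a value taken infinitely often omits some point, which would then
  be missed by infinitely many \<open>U n\<close>.\<close>

lemma range_in_Gamma_covers:
  assumes opn: "\<And>n. openin T (U n)" and proper: "\<And>n. U n \<subset> topspace T"
    and ev: "\<And>x. x \<in> topspace T \<Longrightarrow> \<forall>\<^sub>F n in sequentially. x \<in> U n"
  shows "range U \<in> Gamma_covers T"
proof -
  have fin: "finite {n. x \<notin> U n}" if "x \<in> topspace T" for x
    using ev[OF that] by (simp add: cofinite_eq_sequentially[symmetric] eventually_cofinite)
  have inf: "infinite (range U)"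
  proof
    assume "finite (range U)"
    then obtain n where "infinite {k. U k = U n}"
      using pigeonhole_infinite[of UNIV U] by auto
    moreover obtain x where "x \<in> topspace T" "x \<notin> U n" using proper by blast
    then have "{k. U k = U n} \<subseteq> {k. x \<notin> U k}" "finite {k. x \<notin> U k}"
      using fin by auto
    ultimately show False using finite_subset by blast
  qed
  have fin': "finite {W \<in> range U. x \<notin> W}" if "x \<in> topspace T" for x
    by (rule finite_subset[OF _ finite_imageI[OF fin[OF that], of U]]) auto
  have "topspace T \<subseteq> \<Union> (range U)"
  proof
    fix x assume "x \<in> topspace T"
    from eventually_happens'[OF sequentially_bot ev[OF this]]
    show "x \<in> \<Union> (range U)" by auto
  qed
  moreover have "\<Union> (range U) \<subseteq> topspace T"
    using proper by (intro Union_least) auto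
  ultimately have "\<Union> (range U) = topspace T" by (intro subset_antisym)
  moreover have "\<forall>W\<in>range U. W \<subset> topspace T" "\<forall>W\<in>range U. openin T W"
    using opn proper by blast+
  ultimately show ?thesis
    using inf fin' unfolding Gamma_covers_def gamma_cover_def cover_of_def by blast
qed

theorem corollary3p4:
  fixes X :: "nat set set" and m :: nat
  assumes "generalized_tower bfrak X"
    and "1 \<le> m"
  shows "S1_Gamma_Gamma
    (product_topology (\<lambda>_. subtopology powerset_topology (X \<union> finsets)) {1..m})"
  unfolding S1_Gamma_Gamma_def
proof (intro allI impI)
  let ?Q = "X \<union> finsets"
  let ?T = "product_topology (\<lambda>_. subtopology powerset_topology ?Q) {1..m}"
  fix \<U> :: "nat \<Rightarrow> (nat \<Rightarrow> nat set) set set"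
  assume \<U>: "\<forall>n. \<U> n \<in> Gamma_covers ?T"
  have Q: "?Q \<subseteq> Pow {1..}"
    using assms(1) by (auto simp: generalized_tower_def infsets_def finsets_def)
  have top: "topspace ?T = PiE {1..m} (\<lambda>_. ?Q)"
    using Q by (simp add: inf.absorb2 Int_absorb1)
  have inf: "infinite (\<U> n)" for n
    using \<U> by (simp add: Gamma_covers_def gamma_cover_def)
  \<comment> \<open>A countably infinite part of each cover suffices; injectivity turns finitely
    many exceptional members into finitely many exceptional indices.\<close>
  have "\<forall>n. \<exists>e::nat \<Rightarrow> _. inj e \<and> range e \<subseteq> \<U> n"
    using inf infinite_countable_subset by blast
  then obtain e :: "nat \<Rightarrow> nat \<Rightarrow> (nat \<Rightarrow> nat set) set"
    where e: "\<And>n. inj (e n)" "\<And>n. range (e n) \<subseteq> \<U> n"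
    by metis
  have e_in: "e n k \<in> \<U> n" for n k using e(2) by blast
  have e_open: "openin ?T (e n k)" and e_proper: "e n k \<subset> topspace ?T" for n k
    using \<U> e_in[of n k] by (auto simp: Gamma_covers_def gamma_cover_def cover_of_def)
  have e_ev: "\<forall>\<^sub>F k in sequentially. x \<in> e n k" if "x \<in> topspace ?T" for x n
  proof -
    have "finite {W \<in> \<U> n. x \<notin> W}"
      using \<U> that by (simp add: Gamma_covers_def gamma_cover_def)
    then have "finite (e n -` {W \<in> \<U> n. x \<notin> W})" using e(1) by (rule finite_vimageI)
    then show ?thesis
      using e_in by (simp add: cofinite_eq_sequentially[symmetric] eventually_cofinite vimage_def)
  qed
  \<comment> \<open>These intersections need not belong to any of the covers; the final choice is
    the larger set \<open>e n (\<sigma> n)\<close>.\<close>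
  define V where "V n k = (\<Inter>i\<le>n. e i k)" for n k
  have V_open: "prefix_open {1..m} (PiE {1..m} (\<lambda>_. ?Q)) (V n k)" for n k
    unfolding V_def using e_open Q by (intro openin_power_prefix_open openin_INT2) auto
  have V_dec: "V j k \<subseteq> V i k" if "i \<le> j" for i j k
    using that by (auto simp: V_def)
  have V_ev: "\<forall>\<^sub>F k in sequentially. x \<in> V n k" if "x \<in> PiE {1..m} (\<lambda>_. ?Q)" for n x
    unfolding V_def INT_iff
    by (intro eventually_ball_finite ballI e_ev) (use that in \<open>simp_all only: top finite_atMost\<close>)
  obtain \<sigma> where \<sigma>:
    "\<And>x. x \<in> PiE {1..m} (\<lambda>_. ?Q) \<Longrightarrow> \<forall>\<^sub>F n in sequentially. x \<in> V n (\<sigma> n)"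
    by (rule tower_selection[where V = V, OF assms(1) finite_atLeastAtMost V_open V_dec V_ev])
      (assumption | rule that)+
  have "range (\<lambda>n. e n (\<sigma> n)) \<in> Gamma_covers ?T"
  proof (rule range_in_Gamma_covers)
    show "\<forall>\<^sub>F n in sequentially. x \<in> e n (\<sigma> n)" if "x \<in> topspace ?T" for x
      by (rule eventually_mono[OF \<sigma>]) (use that in \<open>auto simp: top V_def\<close>)
  qed (use e_open e_proper in auto)
  then show "\<exists>U. (\<forall>n. U n \<in> \<U> n) \<and> range U \<in> Gamma_covers ?T"
    using e_in by (intro exI[of _ "\<lambda>n. e n (\<sigma> n)"]) auto
qed

end
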